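(* The $10$-dimensional Banach algebra $$A=\mathbb{C}\big\langle x_1,x_2,x_3,x_4 \,\big|\, x_1x_2=x_3x_4,\ x_i^2=0,\ x_ix_j=-x_jx_i,\ i,j=1,2,3,4\big\rangle$$ is not zero Lie product determined.
   Context: $A$ is the unital associative complex algebra with generators $x_1,x_2,x_3,x_4$ and the displayed relations (the Grassmann algebra on four generators with the additional relation $x_1x_2=x_3x_4$); it is finite dimensional and is regarded as a Banach algebra under any submultiplicative norm (bilinear and linear functionals on it are automatically continuous). For elements $a,b$ of an algebra, $[a,b]=ab-ba$. $A^*$ denotes the dual of $A$. A Banach algebra $A$ is called zero Lie product determined if for every continuous bilinear functional $\varphi\colon A\times A\to\mathbb{C}$ satisfying: for all $a,b\in A$, $[a,b]=0$ implies $\varphi(a,b)=0$, there exists $\tau\in A^*$ such that $\varphi(a,b)=\tau([a,b])$ for all $a,b\in A$. *)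

theory Defs
  imports "HOL-Analysis.Analysis" "HOL-Library.Poly_Mapping"
begin

section \<open>Complex Banach algebras\<close>

text \<open>
  HOL-Analysis only has \<^emph>\<open>real\<close> Banach algebras as a type class, and a type class fixes the norm.
  Here the scalars are complex and the norm varies over one fixed algebra, so the
  scalar multiplication and the norm are locale parameters.
\<close>

locale complex_algebra = vector_space smul
  for smul :: "complex \<Rightarrow> 'a::ring \<Rightarrow> 'a" +
  assumes scale_mult_left: "smul c a * b = smul c (a * b)"
    and scale_mult_right: "a * smul c b = smul c (a * b)"

locale normed_complex_algebra = complex_algebra smul
  for smul :: "complex \<Rightarrow> 'a::ring \<Rightarrow> 'a" +
  fixes nrm :: "'a \<Rightarrow> real"
  assumes nrm_nonneg: "0 \<le> nrm a"
    and nrm_eq_0_iff: "nrm a = 0 \<longleftrightarrow> a = 0"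
    and nrm_triangle: "nrm (a + b) \<le> nrm a + nrm b"
    and nrm_scale: "nrm (smul c a) = cmod c * nrm a"
    and nrm_mult: "nrm (a * b) \<le> nrm a * nrm b"

definition norm_dist :: "('a::ring \<Rightarrow> real) \<Rightarrow> 'a \<Rightarrow> 'a \<Rightarrow> real"
  where "norm_dist nrm a b = nrm (a - b)"

definition norm_topology :: "('a::ring \<Rightarrow> real) \<Rightarrow> 'a topology"
  where "norm_topology nrm = Metric_space.mtopology UNIV (norm_dist nrm)"

locale complex_Banach_algebra = normed_complex_algebra smul nrm
  for smul :: "complex \<Rightarrow> 'a::ring \<Rightarrow> 'a" and nrm :: "'a \<Rightarrow> real" +
  assumes complete: "Metric_space.mcomplete UNIV (norm_dist nrm)"

definition lie_product :: "'a::ring \<Rightarrow> 'a \<Rightarrow> 'a"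
  where "lie_product a b = a * b - b * a"

definition dual_space :: "(complex \<Rightarrow> 'a::ring \<Rightarrow> 'a) \<Rightarrow> ('a \<Rightarrow> real) \<Rightarrow> ('a \<Rightarrow> complex) set"
  where "dual_space smul nrm =
    {\<tau>. Vector_Spaces.linear smul (*) \<tau> \<and> continuous_map (norm_topology nrm) euclidean \<tau>}"

definition continuous_bilinear_functional ::
    "(complex \<Rightarrow> 'a::ring \<Rightarrow> 'a) \<Rightarrow> ('a \<Rightarrow> real) \<Rightarrow> ('a \<Rightarrow> 'a \<Rightarrow> complex) \<Rightarrow> bool"
  where "continuous_bilinear_functional smul nrm \<phi> \<longleftrightarrow>
    (\<forall>a. Vector_Spaces.linear smul (*) (\<lambda>b. \<phi> a b)) \<and>
    (\<forall>b. Vector_Spaces.linear smul (*) (\<lambda>a. \<phi> a b)) \<and>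
    continuous_map (prod_topology (norm_topology nrm) (norm_topology nrm)) euclidean
      (\<lambda>(a, b). \<phi> a b)"

definition zero_Lie_product_determined ::
    "(complex \<Rightarrow> 'a::ring \<Rightarrow> 'a) \<Rightarrow> ('a \<Rightarrow> real) \<Rightarrow> bool"
  where "zero_Lie_product_determined smul nrm \<longleftrightarrow>
    (\<forall>\<phi>. continuous_bilinear_functional smul nrm \<phi> \<and>
         (\<forall>a b. lie_product a b = 0 \<longrightarrow> \<phi> a b = 0) \<longrightarrow>
         (\<exists>\<tau>\<in>dual_space smul nrm. \<forall>a b. \<phi> a b = \<tau> (lie_product a b)))"


section \<open>Free algebras and two-sided ideals\<close>

text \<open>
  The free monoid of words, written additively because the product of finitely supported
  functions in \<^theory>\<open>HOL-Library.Poly_Mapping\<close> is convolution over an additive monoid of exponents.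
\<close>

datatype 'g word = Word "'g list"

instantiation word :: (type) monoid_add
begin

definition zero_word :: "'a word" where "zero_word = Word []"

fun plus_word :: "'a word \<Rightarrow> 'a word \<Rightarrow> 'a word"
  where "plus_word (Word u) (Word v) = Word (u @ v)"

instance
proof
  fix a b c :: "'a word"
  show "a + b + c = a + (b + c)" by (cases a; cases b; cases c) simp
  show "0 + a = a" by (cases a) (simp add: zero_word_def)
  show "a + 0 = a" by (cases a) (simp add: zero_word_def)
qed

end

lemma plus_word_eq_0_iff: "(u :: 'g word) + v = 0 \<longleftrightarrow> u = 0 \<and> v = 0"
  by (cases u; cases v) (simp add: zero_word_def)

type_synonym 'g free_algebra = "'g word \<Rightarrow>\<^sub>0 complex"

definition free_var :: "'g \<Rightarrow> 'g free_algebra"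
  where "free_var g = Poly_Mapping.single (Word [g]) 1"

definition free_const :: "complex \<Rightarrow> 'g free_algebra"
  where "free_const c = Poly_Mapping.single 0 c"

definition two_sided_ideal :: "'a::ring_1 set \<Rightarrow> bool"
  where "two_sided_ideal I \<longleftrightarrow>
    0 \<in> I \<and> (\<forall>a\<in>I. \<forall>b\<in>I. a + b \<in> I) \<and> (\<forall>a\<in>I. \<forall>r. r * a \<in> I \<and> a * r \<in> I)"

definition ideal_generated_by :: "'a::ring_1 set \<Rightarrow> 'a set"
  where "ideal_generated_by S = \<Inter>{I. two_sided_ideal I \<and> S \<subseteq> I}"

lemma two_sided_ideal_generated: "two_sided_ideal (ideal_generated_by S)"
  unfolding ideal_generated_by_def two_sided_ideal_def by blast

lemma ideal_generated_by_superset: "S \<subseteq> ideal_generated_by S"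
  unfolding ideal_generated_by_def by blast

lemma ideal_generated_by_least: "two_sided_ideal I \<Longrightarrow> S \<subseteq> I \<Longrightarrow> ideal_generated_by S \<subseteq> I"
  unfolding ideal_generated_by_def by blast


section \<open>The algebra presented by the given generators and relations\<close>

datatype gen = G1 | G2 | G3 | G4

text \<open>A relation \<open>l = r\<close> is represented by the element \<open>l - r\<close> of the free algebra.\<close>

definition relators :: "gen free_algebra set"
  where "relators =
    {free_var G1 * free_var G2 - free_var G3 * free_var G4}
    \<union> {free_var i * free_var i | i. True}
    \<union> {free_var i * free_var j - (- (free_var j * free_var i)) | i j. True}"

definition relation_ideal :: "gen free_algebra set"
  where "relation_ideal = ideal_generated_by relators"

lemma relation_ideal_zero: "0 \<in> relation_ideal"
  and relation_ideal_add: "a \<in> relation_ideal \<Longrightarrow> b \<in> relation_ideal \<Longrightarrow> a + b \<in> relation_ideal"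
  and relation_ideal_left: "a \<in> relation_ideal \<Longrightarrow> r * a \<in> relation_ideal"
  and relation_ideal_right: "a \<in> relation_ideal \<Longrightarrow> a * r \<in> relation_ideal"
  using two_sided_ideal_generated[of relators]
  unfolding relation_ideal_def two_sided_ideal_def by blast+

lemma relation_ideal_uminus: "a \<in> relation_ideal \<Longrightarrow> - a \<in> relation_ideal"
  using relation_ideal_left[of a "- 1"] by simp

lemma lookup_mult_0:
  fixes p q :: "'g free_algebra"
  shows "Poly_Mapping.lookup (p * q) 0 = Poly_Mapping.lookup p 0 * Poly_Mapping.lookup q 0"
proof -
  let ?p = "Poly_Mapping.lookup p" and ?q = "Poly_Mapping.lookup q"
  have "Poly_Mapping.lookup (p * q) 0 = Sum_any (\<lambda>l. ?p l * Sum_any (\<lambda>r. ?q r when 0 = l + r))"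
    by (rule lookup_mult)
  also have "\<dots> = Sum_any (\<lambda>l :: 'g word. (?p 0 * ?q 0) when l = 0)"
  proof (rule Sum_any.cong)
    fix l :: "'g word"
    have eq: "(0 = l + r) = (l = 0 \<and> r = 0)" for r :: "'g word"
      by (metis plus_word_eq_0_iff)
    have "Sum_any (\<lambda>r. ?q r when 0 = l + r) = Sum_any (\<lambda>r :: 'g word. (?q 0 when l = 0) when r = 0)"
      by (rule Sum_any.cong) (auto simp: when_def eq)
    also have "\<dots> = (?q 0 when l = 0)" by simp
    finally show "?p l * Sum_any (\<lambda>r. ?q r when 0 = l + r) = ((?p 0 * ?q 0) when l = 0)"
      by (simp add: when_def)
  qed
  also have "\<dots> = ?p 0 * ?q 0" by simp
  finally show ?thesis .
qed

lemma one_notin_relation_ideal: "1 \<notin> relation_ideal"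
proof -
  let ?I = "{p :: gen free_algebra. Poly_Mapping.lookup p 0 = 0}"
  have ideal: "two_sided_ideal ?I"
    by (simp add: two_sided_ideal_def lookup_add lookup_mult_0)
  have var: "Poly_Mapping.lookup (free_var i) 0 = 0" for i :: gen
    by (simp add: free_var_def lookup_single zero_word_def)
  have "relators \<subseteq> ?I"
    by (auto simp: relators_def lookup_add lookup_minus lookup_mult_0 var)
  with ideal have "relation_ideal \<subseteq> ?I"
    unfolding relation_ideal_def by (rule ideal_generated_by_least)
  moreover have "(1 :: gen free_algebra) \<notin> ?I" by (simp add: lookup_one)
  ultimately show ?thesis by blast
qed

definition rel_cong :: "gen free_algebra \<Rightarrow> gen free_algebra \<Rightarrow> bool"
  where "rel_cong p q \<longleftrightarrow> p - q \<in> relation_ideal"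

lemma rel_cong_equivp: "equivp rel_cong"
proof (rule equivpI)
  show "reflp rel_cong" by (simp add: reflp_def rel_cong_def relation_ideal_zero)
  show "symp rel_cong"
    unfolding symp_def rel_cong_def by (metis minus_diff_eq relation_ideal_uminus)
  show "transp rel_cong"
    unfolding transp_def rel_cong_def by (metis diff_add_cancel add_diff_eq relation_ideal_add)
qed

quotient_type algA = "gen free_algebra" / rel_cong
  by (rule rel_cong_equivp)

instantiation algA :: ring_1
begin

lift_definition zero_algA :: algA is 0 .

lift_definition one_algA :: algA is 1 .

lift_definition plus_algA :: "algA \<Rightarrow> algA \<Rightarrow> algA" is "(+)"
  unfolding rel_cong_def by (metis add_diff_add relation_ideal_add)

lift_definition uminus_algA :: "algA \<Rightarrow> algA" is uminus
  unfolding rel_cong_def by (metis minus_diff_minus relation_ideal_uminus)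

lift_definition minus_algA :: "algA \<Rightarrow> algA \<Rightarrow> algA" is "(-)"
proof -
  fix p p' q q' :: "gen free_algebra"
  assume "rel_cong p p'" "rel_cong q q'"
  then have "(p - p') + - (q - q') \<in> relation_ideal"
    unfolding rel_cong_def by (intro relation_ideal_add relation_ideal_uminus)
  then show "rel_cong (p - q) (p' - q')"
    unfolding rel_cong_def by (simp add: algebra_simps)
qed

lift_definition times_algA :: "algA \<Rightarrow> algA \<Rightarrow> algA" is "(*)"
proof -
  fix p p' q q' :: "gen free_algebra"
  assume "rel_cong p p'" "rel_cong q q'"
  then have "(p - p') * q + p' * (q - q') \<in> relation_ideal"
    unfolding rel_cong_def by (intro relation_ideal_add relation_ideal_left relation_ideal_right)
  then show "rel_cong (p * q) (p' * q')"
    unfolding rel_cong_def by (simp add: algebra_simps)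
qed

instance
proof
  show "(0 :: algA) \<noteq> 1"
    by transfer (metis rel_cong_def diff_0 minus_minus one_notin_relation_ideal relation_ideal_uminus)
qed (transfer, simp add: rel_cong_def relation_ideal_zero algebra_simps)+

end

lift_definition scaleA :: "complex \<Rightarrow> algA \<Rightarrow> algA" is "\<lambda>c p. free_const c * p"
  unfolding rel_cong_def by (metis right_diff_distrib relation_ideal_left)

lemma free_const_simps:
  "free_const (c + d) = free_const c + free_const d"
  "free_const (c * d) = free_const c * free_const d"
  "free_const 1 = 1"
  by (simp_all add: free_const_def single_add mult_single)

lemma free_const_commute:
  fixes p :: "'g free_algebra"
  shows "free_const c * p = p * free_const c"
proof (induction p rule: update_induct)
  case const
  show ?case by simp
next
  case (update f a b)
  have "Poly_Mapping.update a b f = f + Poly_Mapping.single a b"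
    using update(1)
    by (intro poly_mapping_eqI)
      (auto simp: lookup_update lookup_add lookup_single when_def in_keys_iff)
  moreover have "free_const c * Poly_Mapping.single a b = Poly_Mapping.single a b * free_const c"
    by (simp add: free_const_def mult_single mult.commute)
  ultimately show ?case
    using update(3) by (simp add: distrib_left distrib_right)
qed

interpretation algA: complex_algebra scaleA
proof
  fix a b :: complex and x y :: algA
  show "scaleA a (x + y) = scaleA a x + scaleA a y"
    by transfer (simp add: rel_cong_def relation_ideal_zero algebra_simps)
  show "scaleA (a + b) x = scaleA a x + scaleA b x"
    by transfer (simp add: rel_cong_def relation_ideal_zero free_const_simps algebra_simps)
  show "scaleA a (scaleA b x) = scaleA (a * b) x"
    by transfer (simp add: rel_cong_def relation_ideal_zero free_const_simps mult.assoc)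
  show "scaleA 1 x = x"
    by transfer (simp add: rel_cong_def relation_ideal_zero free_const_simps)
  show "scaleA a x * y = scaleA a (x * y)"
    by transfer (simp add: rel_cong_def relation_ideal_zero mult.assoc)
  show "x * scaleA a y = scaleA a (x * y)"
    by transfer (metis rel_cong_def diff_self relation_ideal_zero mult.assoc free_const_commute)
qed

end

theory Submission
  imports Defs
begin

text \<open>
  All products of three generators vanish, and the Lie product of \<open>a\<close> and \<open>b\<close> is twice the
  class of \<open>a\<^sub>1 \<and> b\<^sub>1\<close>, the wedge of their linear parts, modulo \<open>x\<^sub>1 \<and> x\<^sub>2 - x\<^sub>3 \<and> x\<^sub>4\<close>.
  This tensor is not decomposable, so commuting elements have linearly dependent linear
  parts, and every alternating form in the linear parts vanishes on commuting pairs. The form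
  taking the \<open>(x\<^sub>1, x\<^sub>2)\<close> minor is \<open>1\<close> at \<open>(x\<^sub>1, x\<^sub>2)\<close> and \<open>0\<close> at \<open>(x\<^sub>3, x\<^sub>4)\<close>, although both pairs
  have the same Lie product, so it does not factor through the Lie product.
\<close>

section \<open>Normed algebras with finitely many coordinates\<close>

text \<open>The domain is an abstract topology, since the norm is a parameter rather than a class
  operation; continuity of arithmetic on the codomain is therefore transported by composing with the
  pairing map.\<close>

lemma continuous_map_binop:
  fixes h :: "'b::topological_space \<Rightarrow> 'c::topological_space \<Rightarrow> 'd::topological_space"
  assumes "continuous_map X euclidean f" "continuous_map X euclidean g"
    and "continuous_on UNIV (\<lambda>(x, y). h x y)"
  shows "continuous_map X euclidean (\<lambda>x. h (f x) (g x))"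
proof -
  have "continuous_map X euclidean (\<lambda>x. (f x, g x))"
    using continuous_map_pairedI[OF assms(1,2)] by simp
  moreover have "continuous_map euclidean euclidean (\<lambda>(x, y). h x y)"
    using assms(3) by simp
  ultimately have "continuous_map X euclidean ((\<lambda>(x, y). h x y) \<circ> (\<lambda>x. (f x, g x)))"
    by (rule continuous_map_compose)
  then show ?thesis by (simp add: o_def)
qed

text \<open>The two assumptions say that forming combinations of \<open>e\<close> and taking
  coordinates are mutually inverse, that is, \<open>e\<close> is a basis. Linearity of
  \<open>coord\<close> is derived, being the inverse of a linear map.\<close>

locale coordinatized_space = vector_space smul
  for smul :: "complex \<Rightarrow> 'a::ring \<Rightarrow> 'a" +
  fixes e :: "'n::finite \<Rightarrow> 'a" and coord :: "'a \<Rightarrow> 'n \<Rightarrow> complex"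
  assumes coord_comb: "coord (\<Sum>i\<in>UNIV. smul (c i) (e i)) = c"
    and comb_coord: "(\<Sum>i\<in>UNIV. smul (coord a i) (e i)) = a"
begin

lemma coord_add: "coord (a + b) i = coord a i + coord b i"
proof -
  have "a + b = (\<Sum>i\<in>UNIV. smul (coord a i + coord b i) (e i))"
    by (simp add: scale_left_distrib sum.distrib comb_coord)
  then show ?thesis using fun_cong[OF coord_comb[of "\<lambda>i. coord a i + coord b i"], of i] by simp
qed

lemma coord_scale: "coord (smul c a) i = c * coord a i"
proof -
  have "smul c a = (\<Sum>i\<in>UNIV. smul (c * coord a i) (e i))"
    by (simp flip: scale_scale scale_sum_right add: comb_coord)
  then show ?thesis using fun_cong[OF coord_comb[of "\<lambda>i. c * coord a i"], of i] by simp
qed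

lemma coord_zero: "coord 0 i = 0"
  using coord_scale[of 0 0 i] by simp

lemma coord_diff: "coord (a - b) i = coord a i - coord b i"
  using coord_add[of "a - b" b i] by simp

lemma eq_0_iff_coord: "a = 0 \<longleftrightarrow> (\<forall>i. coord a i = 0)"
  using comb_coord[of a] by (auto simp: coord_zero)

lemma coord_basis: "coord (e j) i = (if i = j then 1 else 0)"
proof -
  have "smul (if k = j then 1 else 0) (e k) = (if k = j then e k else 0)" for k
    by simp
  then have "(\<Sum>k\<in>UNIV. smul (if k = j then 1 else 0) (e k)) = e j"
    by simp
  then show ?thesis using fun_cong[OF coord_comb[of "\<lambda>k. if k = j then 1 else 0"], of i] by simp
qed

lemma inj_basis: "inj e"
proof (rule injI)
  fix i j assume "e i = e j"
  then have "coord (e i) i = coord (e j) i" by simp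
  then show "i = j" by (simp add: coord_basis split: if_splits)
qed

lemma linear_coord: "Vector_Spaces.linear smul (*) (\<lambda>a. coord a i)"
  unfolding Vector_Spaces.linear_iff
  by (simp add: vector_space_axioms coord_add coord_scale) (unfold_locales, auto simp: algebra_simps)

lemma dim_UNIV: "dim UNIV = CARD('n)"
proof -
  have "independent (range e)"
  proof (rule independent_if_scalars_zero)
    fix f x
    assume "(\<Sum>x\<in>range e. smul (f x) x) = 0" and x: "x \<in> range e"
    then have "(\<Sum>i\<in>UNIV. smul (f (e i)) (e i)) = 0"
      by (simp add: sum.reindex[OF inj_basis] o_def)
    then have "f (e i) = 0" for i
      using fun_cong[OF coord_comb[of "\<lambda>i. f (e i)"], of i] by (simp add: coord_zero)
    with x show "f x = 0" by auto
  qed simp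
  moreover have "a \<in> span (range e)" for a
    by (subst comb_coord[symmetric]) (intro span_sum span_scale span_base rangeI)
  ultimately have "dim UNIV = card (range e)"
    by (intro dim_unique[where B = "range e"]) auto
  then show ?thesis by (simp add: card_image[OF inj_basis])
qed

end

section \<open>Equivalence of norms in finite dimension\<close>

locale coordinatized_normed_algebra =
  normed_complex_algebra smul nrm + coordinatized_space smul e coord
  for smul :: "complex \<Rightarrow> 'a::ring \<Rightarrow> 'a" and nrm :: "'a \<Rightarrow> real"
    and e :: "'n::finite \<Rightarrow> 'a" and coord :: "'a \<Rightarrow> 'n \<Rightarrow> complex"
begin

lemma nrm_zero: "nrm 0 = 0"
  by (simp add: nrm_eq_0_iff)

lemma nrm_minus: "nrm (- a) = nrm a"
  using nrm_scale[of "- 1" a] by simp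

lemma nrm_sum: "nrm (sum f A) \<le> (\<Sum>i\<in>A. nrm (f i))"
  by (induction A rule: infinite_finite_induct)
    (auto simp: nrm_zero intro: order_trans[OF nrm_triangle])

lemma metric_space: "Metric_space UNIV (norm_dist nrm)"
proof
  fix x y z :: 'a
  show "0 \<le> norm_dist nrm x y" by (simp add: norm_dist_def nrm_nonneg)
  show "norm_dist nrm x y = norm_dist nrm y x"
    using nrm_minus[of "x - y"] by (simp add: norm_dist_def)
  show "norm_dist nrm x y = 0 \<longleftrightarrow> x = y" by (simp add: norm_dist_def nrm_eq_0_iff)
  show "norm_dist nrm x z \<le> norm_dist nrm x y + norm_dist nrm y z"
    using nrm_triangle[of "x - y" "y - z"] by (simp add: norm_dist_def)
qed

lemma nrm_le_coord: "nrm a \<le> (\<Sum>i\<in>UNIV. cmod (coord a i) * nrm (e i))"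
  using nrm_sum[of "\<lambda>i. smul (coord a i) (e i)" UNIV] by (simp add: comb_coord nrm_scale)

text \<open>Compactness of the unit sphere of \<open>\<complex>\<^sup>n\<close> bounds the norm from below.\<close>

lemma coord_bounded:
  obtains D where "0 < D" "\<And>a i. cmod (coord a i) \<le> D * nrm a"
proof -
  define comb :: "complex^'n \<Rightarrow> 'a" where "comb x = (\<Sum>i\<in>UNIV. smul (x $ i) (e i))" for x
  define C where "C = (\<Sum>i\<in>UNIV. nrm (e i))"
  have coord_comb': "coord (comb x) i = x $ i" for x i
    unfolding comb_def coord_comb ..
  have comb_diff: "comb (x - y) = comb x - comb y" for x y
    by (simp add: comb_def scale_left_diff_distrib sum_subtractf)
  have upper: "nrm (comb x) \<le> C * norm x" for x
  proof -
    have "nrm (comb x) \<le> (\<Sum>i\<in>UNIV. cmod (x $ i) * nrm (e i))"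
      using nrm_le_coord[of "comb x"] by (simp add: coord_comb')
    also have "\<dots> \<le> (\<Sum>i\<in>UNIV. norm x * nrm (e i))"
      by (intro sum_mono mult_right_mono nrm_nonneg Finite_Cartesian_Product.norm_nth_le)
    finally show ?thesis by (simp add: C_def mult.commute flip: sum_distrib_right sum_distrib_left)
  qed
  have C: "0 \<le> C" by (simp add: C_def sum_nonneg nrm_nonneg)
  have diff: "\<bar>nrm (comb x) - nrm (comb y)\<bar> \<le> C * norm (x - y)" for x y
    using nrm_triangle[of "comb x" "comb y - comb x"] nrm_triangle[of "comb y" "comb x - comb y"]
      upper[of "x - y"] upper[of "y - x"]
    by (simp add: comb_diff norm_minus_commute)
  have "continuous_on (sphere 0 1) (\<lambda>x. nrm (comb x))"
    unfolding continuous_on_iff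
  proof (intro ballI allI impI)
    fix x y :: "complex^'n" and \<epsilon> :: real
    assume "0 < \<epsilon>"
    show "\<exists>d>0. \<forall>x'\<in>sphere 0 1. dist x' x < d \<longrightarrow> dist (nrm (comb x')) (nrm (comb x)) < \<epsilon>"
    \<comment> \<open>The \<open>+ 1\<close> keeps the denominator positive when \<open>C\<close> is
      \<open>0\<close>.\<close>
    proof (intro exI[of _ "\<epsilon> / (C + 1)"] conjI ballI impI)
      show "0 < \<epsilon> / (C + 1)" using \<open>0 < \<epsilon>\<close> C by simp
      fix x' assume "dist x' x < \<epsilon> / (C + 1)"
      then have "norm (x' - x) * (C + 1) < \<epsilon>"
        using C by (simp add: dist_norm field_simps)
      then show "dist (nrm (comb x')) (nrm (comb x)) < \<epsilon>"
        using diff[of x' x] norm_ge_zero[of "x' - x"] unfolding dist_real_def distrib_left mult.commute[of C]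
        by linarith
    qed
  qed
  moreover have "compact (sphere (0 :: complex^'n) 1)" by simp
  moreover have "sphere (0 :: complex^'n) 1 \<noteq> {}" by simp
  ultimately obtain x0 :: "complex^'n"
    where x0: "norm x0 = 1" "\<And>x. norm x = 1 \<Longrightarrow> nrm (comb x0) \<le> nrm (comb x)"
    using continuous_attains_inf[of "sphere 0 1" "\<lambda>x. nrm (comb x)"] by auto
  define m where "m = nrm (comb x0)"
  have "comb x0 \<noteq> 0"
  proof
    assume "comb x0 = 0"
    then have "x0 = 0" using coord_comb'[of x0] by (simp add: coord_zero vec_eq_iff)
    with x0(1) show False by simp
  qed
  then have m: "0 < m" using nrm_nonneg nrm_eq_0_iff by (simp add: m_def less_le)
  have "cmod (coord a i) \<le> (1 / m) * nrm a" for a i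
  proof (cases "a = 0")
    case True then show ?thesis by (simp add: coord_zero nrm_zero)
  next
    case False
    \<comment> \<open>By homogeneity it suffices to rescale the coordinate vector to the unit
      sphere, where the minimum \<open>m\<close> bounds the norm.\<close>
    define x where "x = (\<chi> i. coord a i)"
    have a: "comb x = a" by (simp add: comb_def x_def comb_coord)
    have "x \<noteq> 0" using False a by (auto simp: comb_def)
    then have "m \<le> nrm (comb (x /\<^sub>R norm x))"
      unfolding m_def by (intro x0(2)) simp
    also have "comb (x /\<^sub>R norm x) = smul (of_real (inverse (norm x))) a"
      unfolding a[symmetric] comb_def vector_scaleR_component scale_sum_right scale_scale
    by (simp only: scaleR_conv_of_real)
    also have "nrm \<dots> = nrm a / norm x" by (simp add: nrm_scale divide_inverse mult.commute norm_inverse)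
    finally have "norm x \<le> 1 / m * nrm a" using m \<open>x \<noteq> 0\<close> by (simp add: field_simps)
    moreover have "cmod (coord a i) \<le> norm x"
      using Finite_Cartesian_Product.norm_nth_le[of x i] by (simp add: x_def)
    ultimately show ?thesis by simp
  qed
  with m show ?thesis by (intro that[of "1 / m"]) auto
qed

text \<open>By \<open>coord_bounded\<close> a Cauchy sequence is Cauchy in each coordinate. The
  coordinatewise limits define the limit element, and \<open>nrm_le_coord\<close> turns
  coordinatewise convergence back into convergence in norm.\<close>

lemma complete: "Metric_space.mcomplete UNIV (norm_dist nrm)"
proof -
  interpret M: Metric_space UNIV "norm_dist nrm" by (rule metric_space)
  obtain D where D: "0 < D" "\<And>a i. cmod (coord a i) \<le> D * nrm a"
    by (rule coord_bounded) blast
  show ?thesis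
    unfolding M.mcomplete_def
  proof (intro allI impI)
    fix \<sigma> assume \<sigma>: "M.MCauchy \<sigma>"
    have "Cauchy (\<lambda>n. coord (\<sigma> n) i)" for i
    proof (rule CauchyI)
      fix \<epsilon> :: real assume "0 < \<epsilon>"
      then obtain N where N: "\<And>n n'. N \<le> n \<Longrightarrow> N \<le> n' \<Longrightarrow> nrm (\<sigma> n - \<sigma> n') < \<epsilon> / D"
        using \<sigma> divide_pos_pos[OF _ D(1)] unfolding M.MCauchy_def norm_dist_def by blast
      have "cmod (coord (\<sigma> n) i - coord (\<sigma> n') i) < \<epsilon>" if "N \<le> n" "N \<le> n'" for n n'
        using D(2)[of "\<sigma> n - \<sigma> n'" i] N[OF that] D(1) by (simp add: coord_diff field_simps)
      then show "\<exists>M. \<forall>m\<ge>M. \<forall>n\<ge>M. cmod (coord (\<sigma> m) i - coord (\<sigma> n) i) < \<epsilon>" by blast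
    qed
    then have "\<exists>l. (\<lambda>n. coord (\<sigma> n) i) \<longlonglongrightarrow> l" for i
      using Cauchy_convergent convergent_def by blast
    then obtain l where l: "\<And>i. (\<lambda>n. coord (\<sigma> n) i) \<longlonglongrightarrow> l i" by metis
    define a where "a = (\<Sum>i\<in>UNIV. smul (l i) (e i))"
    have coord_a: "coord a = l" by (simp add: a_def coord_comb)
    have "(\<lambda>n. \<Sum>i\<in>UNIV. cmod (coord (\<sigma> n - a) i) * nrm (e i)) \<longlonglongrightarrow>
      (\<Sum>i\<in>UNIV. cmod (l i - l i) * nrm (e i))"
      unfolding coord_diff coord_a by (intro tendsto_intros l)
    then have "(\<lambda>n. \<Sum>i\<in>UNIV. cmod (coord (\<sigma> n - a) i) * nrm (e i)) \<longlonglongrightarrow> 0" by simp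
    then have "(\<lambda>n. nrm (\<sigma> n - a)) \<longlonglongrightarrow> 0"
      by (rule real_tendsto_sandwich[rotated 2, OF tendsto_const])
        (simp_all add: nrm_nonneg nrm_le_coord)
    then have "limitin M.mtopology \<sigma> a sequentially"
      unfolding M.limit_metric_sequentially LIMSEQ_iff norm_dist_def by (simp add: nrm_nonneg)
    then show "\<exists>x. limitin M.mtopology \<sigma> x sequentially" by blast
  qed
qed

lemma Banach: "complex_Banach_algebra smul nrm"
  by unfold_locales (rule complete)

text \<open>Coordinates are Lipschitz with the constant \<open>D\<close> of
  \<open>coord_bounded\<close>.\<close>

lemma continuous_coord: "continuous_map (norm_topology nrm) euclidean (\<lambda>a. coord a i)"
proof -
  interpret M: Metric_space UNIV "norm_dist nrm" by (rule metric_space)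
  obtain D where D: "0 < D" "\<And>a i. cmod (coord a i) \<le> D * nrm a"
    by (rule coord_bounded) blast
  have "\<exists>\<delta>>0. \<forall>x. norm_dist nrm a x < \<delta> \<longrightarrow> dist (coord a i) (coord x i) < \<epsilon>"
    if "0 < \<epsilon>" for a \<epsilon>
  proof (intro exI[of _ "\<epsilon> / D"] conjI allI impI)
    fix x assume "norm_dist nrm a x < \<epsilon> / D"
    then show "dist (coord a i) (coord x i) < \<epsilon>"
      using D(2)[of "a - x" i] D(1) by (simp add: norm_dist_def dist_norm coord_diff field_simps)
  qed (use that D in simp)
  then show ?thesis
    \<comment> \<open>Writing the euclidean topology as a metric topology makes the epsilon-delta
      criterion applicable on both sides.\<close>
    unfolding norm_topology_def mtopology_is_euclidean[symmetric]
    by (subst M.metric_continuous_map[OF Met_TC.Metric_space_axioms]) auto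
qed

end

section \<open>Coordinates on the presented algebra\<close>

abbreviation word_coeff :: "'g free_algebra \<Rightarrow> 'g list \<Rightarrow> complex"
  where "word_coeff p w \<equiv> Poly_Mapping.lookup p (Word w)"

text \<open>In the free monoid the factorizations of a word are exactly its cuts into a prefix and a
  suffix, so the convolution is a finite sum over cut positions.\<close>

lemma word_coeff_mult:
  "word_coeff (p * q) w = (\<Sum>k\<le>length w. word_coeff p (take k w) * word_coeff q (drop k w))"
proof -
  let ?f = "\<lambda>u. Poly_Mapping.lookup p u * Sum_any (\<lambda>v. Poly_Mapping.lookup q v when Word w = u + v)"
  let ?t = "\<lambda>k. Word (take k w)"
  have inj: "inj_on ?t {..length w}"
    by (rule inj_onI) (metis atMost_iff length_take min.absorb2 word.inject)
  have "{u. ?f u \<noteq> 0} \<subseteq> ?t ` {..length w}"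
  proof
    fix u assume "u \<in> {u. ?f u \<noteq> 0}"
    then have "Sum_any (\<lambda>v. Poly_Mapping.lookup q v when Word w = u + v) \<noteq> 0" by auto
    then obtain v where "Word w = u + v"
      by (metis (mono_tags, lifting) Sum_any.not_neutral_obtains_not_neutral when_neq_zero)
    moreover obtain x y where "u = Word x" "v = Word y" by (cases u, cases v)
    ultimately show "u \<in> ?t ` {..length w}"
      by (auto intro!: image_eqI[of _ _ "length x"])
  qed
  moreover have "?f (?t k) = word_coeff p (take k w) * word_coeff q (drop k w)"
    if "k \<le> length w" for k
  proof -
    have "(Word w = ?t k + v) = (v = Word (drop k w))" for v
      by (cases v) (auto simp: append_eq_conv_conj that min_def dest: sym)
    then show ?thesis by simp
  qed
  ultimately have "Sum_any ?f = (\<Sum>k\<le>length w. word_coeff p (take k w) * word_coeff q (drop k w))"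
    by (subst Sum_any.expand_superset[of "?t ` {..length w}"])
      (auto simp: sum.reindex[OF inj] simp del: mult_eq_0_iff intro!: sum.cong)
  then show ?thesis by (simp add: lookup_mult)
qed

lemma word_coeff_mult_short:
  "word_coeff (p * q) [] = word_coeff p [] * word_coeff q []"
  "word_coeff (p * q) [i] = word_coeff p [] * word_coeff q [i] + word_coeff p [i] * word_coeff q []"
  "word_coeff (p * q) [i, j] = word_coeff p [] * word_coeff q [i, j] +
    word_coeff p [i] * word_coeff q [j] + word_coeff p [i, j] * word_coeff q []"
  by (simp_all add: word_coeff_mult atMost_Suc)

lemma word_coeff_const [simp]: "word_coeff (free_const c) w = (if w = [] then c else 0)"
  by (simp add: free_const_def lookup_single zero_word_def when_def eq_commute)

lemma word_coeff_var [simp]: "word_coeff (free_var g) w = (if w = [g] then 1 else 0)"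
  by (simp add: free_var_def lookup_single when_def eq_commute)

lemma word_coeff_1 [simp]: "word_coeff 1 w = (if w = [] then 1 else 0)"
  using word_coeff_const[of 1 w] by (simp add: free_const_simps(3))

section \<open>Ten functionals on the free algebra that descend to the quotient\<close>

datatype basis_index = I0 | I1 | I2 | I3 | I4 | I12 | I13 | I14 | I23 | I24

lemma UNIV_basis_index: "UNIV = {I0, I1, I2, I3, I4, I12, I13, I14, I23, I24}"
  using basis_index.exhaust by blast

instance basis_index :: finite
  by standard (simp add: UNIV_basis_index)

abbreviation skew_coeff :: "'g free_algebra \<Rightarrow> 'g \<Rightarrow> 'g \<Rightarrow> complex"
  where "skew_coeff p i j \<equiv> word_coeff p [i, j] - word_coeff p [j, i]"

text \<open>
  Since \<open>x\<^sub>1x\<^sub>2 = x\<^sub>3x\<^sub>4\<close> in the quotient, only the sum of the skew coefficients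
  at \<open>x\<^sub>1x\<^sub>2\<close> and \<open>x\<^sub>3x\<^sub>4\<close> descends to it.
\<close>

fun free_coord :: "gen free_algebra \<Rightarrow> basis_index \<Rightarrow> complex" where
  "free_coord p I0 = word_coeff p []"
| "free_coord p I1 = word_coeff p [G1]"
| "free_coord p I2 = word_coeff p [G2]"
| "free_coord p I3 = word_coeff p [G3]"
| "free_coord p I4 = word_coeff p [G4]"
| "free_coord p I12 = skew_coeff p G1 G2 + skew_coeff p G3 G4"
| "free_coord p I13 = skew_coeff p G1 G3"
| "free_coord p I14 = skew_coeff p G1 G4"
| "free_coord p I23 = skew_coeff p G2 G3"
| "free_coord p I24 = skew_coeff p G2 G4"

text \<open>These are the structure constants of the algebra: the unit acts through
  \<open>I0\<close>, and two linear parts multiply by their wedge, with the (3,4) minor added into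
  \<open>I12\<close>.\<close>

fun coord_product :: "(basis_index \<Rightarrow> complex) \<Rightarrow> (basis_index \<Rightarrow> complex) \<Rightarrow> basis_index \<Rightarrow> complex" where
  "coord_product a b I0 = a I0 * b I0"
| "coord_product a b I12 =
    a I0 * b I12 + a I12 * b I0 + a I1 * b I2 - a I2 * b I1 + a I3 * b I4 - a I4 * b I3"
| "coord_product a b I13 = a I0 * b I13 + a I13 * b I0 + a I1 * b I3 - a I3 * b I1"
| "coord_product a b I14 = a I0 * b I14 + a I14 * b I0 + a I1 * b I4 - a I4 * b I1"
| "coord_product a b I23 = a I0 * b I23 + a I23 * b I0 + a I2 * b I3 - a I3 * b I2"
| "coord_product a b I24 = a I0 * b I24 + a I24 * b I0 + a I2 * b I4 - a I4 * b I2"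
| "coord_product a b i = a I0 * b i + a i * b I0"

lemma free_coord_linear:
  "free_coord 0 i = 0"
  "free_coord (p + q) i = free_coord p i + free_coord q i"
  "free_coord (p - q) i = free_coord p i - free_coord q i"
  by (cases i; simp add: lookup_add lookup_minus)+

lemma free_coord_scale: "free_coord (free_const c * p) i = c * free_coord p i"
  by (cases i) (simp_all add: word_coeff_mult_short algebra_simps)

lemma free_coord_one: "free_coord 1 i = (if i = I0 then 1 else 0)"
  by (cases i) simp_all

lemma free_coord_var:
  "free_coord (free_var G1) i = (if i = I1 then 1 else 0)"
  "free_coord (free_var G2) i = (if i = I2 then 1 else 0)"
  "free_coord (free_var G3) i = (if i = I3 then 1 else 0)"
  "free_coord (free_var G4) i = (if i = I4 then 1 else 0)"
  by (cases i; simp)+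

lemma free_coord_mult: "free_coord (p * q) i = coord_product (free_coord p) (free_coord q) i"
  by (cases i) (simp_all add: word_coeff_mult_short algebra_simps)

text \<open>By \<open>free_coord_mult\<close> the coordinates of a product depend only on those of
  its factors, so their common kernel is a two-sided ideal; it contains the relators.\<close>

lemma free_coord_relation_ideal:
  assumes "p \<in> relation_ideal"
  shows "free_coord p i = 0"
proof -
  let ?I = "{p. \<forall>i. free_coord p i = 0}"
  have product_zero: "coord_product a b i = 0" if "(\<forall>i. a i = 0) \<or> (\<forall>i. b i = 0)" for a b i
    using that by (cases i) auto
  have "two_sided_ideal ?I"
    by (simp add: two_sided_ideal_def free_coord_linear free_coord_mult product_zero)
  moreover have "free_coord r i = 0" if "r \<in> relators" for r i
    using that by (cases i) (auto simp: relators_def lookup_add lookup_minus word_coeff_mult_short)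
  then have "relators \<subseteq> ?I" by blast
  ultimately have "relation_ideal \<subseteq> ?I"
    unfolding relation_ideal_def by (rule ideal_generated_by_least)
  with assms show ?thesis by blast
qed

lift_definition coordA :: "algA \<Rightarrow> basis_index \<Rightarrow> complex" is free_coord
  using free_coord_relation_ideal by (fastforce simp: rel_cong_def free_coord_linear)

lift_definition varA :: "gen \<Rightarrow> algA" is free_var .

lemma coordA_zero: "coordA 0 i = 0"
  by transfer (simp add: free_coord_linear)

lemma coordA_add: "coordA (a + b) i = coordA a i + coordA b i"
  by transfer (simp add: free_coord_linear)

lemma coordA_mult: "coordA (a * b) i = coord_product (coordA a) (coordA b) i"
  by transfer (simp add: free_coord_mult)

lemma coordA_scale: "coordA (scaleA c a) i = c * coordA a i"
  by transfer (rule free_coord_scale)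

lemma coordA_one: "coordA 1 i = (if i = I0 then 1 else 0)"
  by transfer (rule free_coord_one)

lemma coordA_sum: "coordA (sum f S) i = (\<Sum>s\<in>S. coordA (f s) i)"
  by (induction S rule: infinite_finite_induct) (simp_all add: coordA_zero coordA_add)

lemma coordA_var:
  "coordA (varA G1) i = (if i = I1 then 1 else 0)"
  "coordA (varA G2) i = (if i = I2 then 1 else 0)"
  "coordA (varA G3) i = (if i = I3 then 1 else 0)"
  "coordA (varA G4) i = (if i = I4 then 1 else 0)"
  by (transfer, rule free_coord_var)+

section \<open>Identities between the generators of the quotient\<close>

lemma relator_in_ideal: "r \<in> relators \<Longrightarrow> r \<in> relation_ideal"
  unfolding relation_ideal_def using ideal_generated_by_superset by blast

lemma varA_square: "varA i * varA i = 0"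
  by transfer (auto simp: rel_cong_def relators_def intro!: relator_in_ideal)

lemma varA_anticommute: "varA i * varA j = - (varA j * varA i)"
proof (transfer, unfold rel_cong_def, rule relator_in_ideal)
  fix i j
  show "free_var i * free_var j - - (free_var j * free_var i) \<in> relators"
    unfolding relators_def by blast
qed

lemma varA_12: "varA G1 * varA G2 = varA G3 * varA G4"
  by transfer (simp add: rel_cong_def relators_def relator_in_ideal)

text \<open>Rewrite rules to normal form: indices increase, and \<open>x3 x4\<close> is eliminated
  in favour of \<open>x1 x2\<close>.\<close>

lemma varA_sorted:
  "varA G2 * varA G1 = - (varA G1 * varA G2)"
  "varA G3 * varA G1 = - (varA G1 * varA G3)"
  "varA G4 * varA G1 = - (varA G1 * varA G4)"
  "varA G3 * varA G2 = - (varA G2 * varA G3)"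
  "varA G4 * varA G2 = - (varA G2 * varA G4)"
  "varA G4 * varA G3 = - (varA G1 * varA G2)"
  "varA G3 * varA G4 = varA G1 * varA G2"
  by (rule varA_anticommute)+ (use varA_anticommute[of G4 G3] in \<open>simp_all add: varA_12\<close>)

lemma varA_square_left: "varA i * (varA i * a) = 0"
  by (simp add: varA_square flip: mult.assoc)

lemma varA_left_anticommute: "varA i * (varA j * a) = - (varA j * (varA i * a))"
  using varA_anticommute[of i j] by (simp flip: mult.assoc)

lemma varA_alternate: "varA i * (varA j * varA i) = 0"
  using varA_anticommute[of j i] by (simp add: varA_square_left)

text \<open>Three distinct indices include the pair 1, 2 or the pair 3, 4, and the third index lies
  in the other pair. Exchanging the pairs by \<open>varA_12\<close> repeats a generator, so the
  product vanishes.\<close>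

lemma varA_cube: "varA i * (varA j * varA k) = 0"
proof -
  have 1: "varA G1 * (varA G3 * varA G4) = 0"
    by (simp add: varA_square_left flip: varA_12)
  have 2: "varA G2 * (varA G3 * varA G4) = 0"
    by (simp add: varA_alternate flip: varA_12)
  \<comment> \<open>Moving \<open>x3\<close> to the front past two generators produces two
    cancelling signs and exposes \<open>x1 x2\<close>.\<close>
  have "varA G1 * (varA G2 * varA G3) = varA G3 * (varA G1 * varA G2)"
    by (simp add: varA_sorted(4) varA_left_anticommute[of G3 G1])
  then have 3: "varA G1 * (varA G2 * varA G3) = 0"
    by (simp add: varA_square_left varA_12)
  have "varA G1 * (varA G2 * varA G4) = varA G4 * (varA G1 * varA G2)"
    by (simp add: varA_sorted(5) varA_left_anticommute[of G4 G1])
  then have 4: "varA G1 * (varA G2 * varA G4) = 0"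
    by (simp add: varA_alternate varA_12)
  \<comment> \<open>Only index-sorting instances are taken, so that rewriting terminates. Here
    \<open>x4 x3\<close> becomes \<open>- (x3 x4)\<close>, leaving \<open>x3 x4\<close> in place so
    that facts 1 and 2 match.\<close>
  note sort = varA_sorted(1-5) varA_anticommute[of G4 G3]
    varA_left_anticommute[of G2 G1] varA_left_anticommute[of G3 G1]
    varA_left_anticommute[of G4 G1] varA_left_anticommute[of G3 G2]
    varA_left_anticommute[of G4 G2] varA_left_anticommute[of G4 G3]
  show ?thesis
    by (cases i; cases j; cases k)
      (simp_all add: 1 2 3 4 sort varA_square varA_square_left)
qed

section \<open>A monomial basis of the quotient\<close>

fun basisA :: "basis_index \<Rightarrow> algA" where
  "basisA I0 = 1"
| "basisA I1 = varA G1"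
| "basisA I2 = varA G2"
| "basisA I3 = varA G3"
| "basisA I4 = varA G4"
| "basisA I12 = varA G1 * varA G2"
| "basisA I13 = varA G1 * varA G3"
| "basisA I14 = varA G1 * varA G4"
| "basisA I23 = varA G2 * varA G3"
| "basisA I24 = varA G2 * varA G4"

lemma coordA_basis: "coordA (basisA i) j = (if i = j then 1 else 0)"
  by (cases i; cases j) (simp_all add: coordA_one coordA_var coordA_mult)

text \<open>Monomials of degree 0 and 1 rise by one degree and are normalized by
  \<open>varA_sorted\<close>; those of degree 2 are killed by \<open>varA_cube\<close>.\<close>

lemma var_mult_basis_in_span: "varA g * basisA i \<in> algA.span (range basisA)"
proof -
  have base: "basisA i \<in> algA.span (range basisA)" for i
    by (intro algA.span_base rangeI)
  note gens = base[of I1] base[of I2] base[of I3] base[of I4] base[of I12] base[of I13]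
    base[of I14] base[of I23] base[of I24]
  show ?thesis
    using gens
    by (cases g; cases i)
      (simp_all add: varA_cube varA_square varA_sorted algA.span_zero algA.span_neg)
qed

lemma var_mult_in_span:
  assumes "a \<in> algA.span (range basisA)"
  shows "varA g * a \<in> algA.span (range basisA)"
  using assms
proof (induction rule: algA.span_induct)
  case base
  show ?case
    by (auto simp: algA.subspace_def algA.span_zero algA.span_add algA.span_scale distrib_left
        algA.scale_mult_right)
next
  case (step a)
  then show ?case using var_mult_basis_in_span by auto
qed

text \<open>A word arises from the empty one by left multiplications with generators, under which
  the span is closed.\<close>

lemma abs_algA_single_in_span: "abs_algA (Poly_Mapping.single (Word w) c) \<in> algA.span (range basisA)"
proof (induction w)
  case Nil
  have "abs_algA (Poly_Mapping.single (Word []) c) = scaleA c (basisA I0)"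
    by (simp add: one_algA_def scaleA.abs_eq free_const_def zero_word_def)
  then show ?case by (simp only: algA.span_scale algA.span_base rangeI)
next
  case (Cons g w)
  have "Poly_Mapping.single (Word (g # w)) c = free_var g * Poly_Mapping.single (Word w) c"
    by (simp add: free_var_def mult_single)
  then have "abs_algA (Poly_Mapping.single (Word (g # w)) c) =
      varA g * abs_algA (Poly_Mapping.single (Word w) c)"
    by (simp add: varA.abs_eq times_algA.abs_eq)
  with Cons show ?case by (simp add: var_mult_in_span)
qed

lemma span_basisA: "a \<in> algA.span (range basisA)"
proof (induct a rule: algA.abs_induct)
  case (1 p)
  show "abs_algA p \<in> algA.span (range basisA)"
  proof (induction p rule: update_induct)
    case const
    show ?case using algA.span_zero by (simp add: zero_algA_def)
  next
    case (update f u c)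
    have "Poly_Mapping.update u c f = f + Poly_Mapping.single u c"
      using update(1)
      by (intro poly_mapping_eqI)
        (auto simp: lookup_update lookup_add lookup_single when_def in_keys_iff)
    then have "abs_algA (Poly_Mapping.update u c f) = abs_algA f + abs_algA (Poly_Mapping.single u c)"
      by (simp add: plus_algA.abs_eq)
    with update(3) abs_algA_single_in_span show ?case
      by (cases u) (simp add: algA.span_add)
  qed
qed

text \<open>Duality of \<open>coordA\<close> and \<open>basisA\<close> gives independence, and
  \<open>span_basisA\<close> gives spanning.\<close>

interpretation coordsA: coordinatized_space scaleA basisA coordA
proof
  show "coordA (\<Sum>i\<in>UNIV. scaleA (c i) (basisA i)) = c" for c
    by (rule ext) (simp add: coordA_sum coordA_scale coordA_basis if_distrib cong: if_cong)
  show "(\<Sum>i\<in>UNIV. scaleA (coordA a i) (basisA i)) = a" for a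
    using span_basisA[of a]
  proof (induction rule: algA.span_induct)
    case base
    show ?case
      by (simp add: algA.subspace_def coordA_zero coordA_add coordA_scale algA.scale_left_distrib
          sum.distrib flip: algA.scale_scale algA.scale_sum_right)
  next
    case (step a)
    then obtain j where a: "a = basisA j" by blast
    have "scaleA (coordA a i) (basisA i) = (if i = j then basisA j else 0)" for i
      by (simp add: a coordA_basis)
    then show ?case by (simp add: a)
  qed
qed

section \<open>Existence of a submultiplicative norm\<close>

definition l1_norm :: "algA \<Rightarrow> real"
  where "l1_norm a = (\<Sum>i\<in>UNIV. cmod (coordA a i))"

text \<open>A product of two basis monomials is zero or, up to sign, a basis monomial. Hence each
  \<open>A i * B j\<close> is charged to at most one coordinate of the product.\<close>

lemma normed_l1_norm: "normed_complex_algebra scaleA l1_norm"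
proof
  fix a b :: algA and c :: complex
  show "0 \<le> l1_norm a" by (simp add: l1_norm_def sum_nonneg)
  show "l1_norm a = 0 \<longleftrightarrow> a = 0"
    by (simp add: l1_norm_def sum_nonneg_eq_0_iff coordsA.eq_0_iff_coord)
  show "l1_norm (a + b) \<le> l1_norm a + l1_norm b"
    by (simp add: l1_norm_def coordA_add norm_triangle_ineq sum_mono flip: sum.distrib)
  show "l1_norm (scaleA c a) = cmod c * l1_norm a"
    by (simp add: l1_norm_def coordA_scale norm_mult sum_distrib_left)
  have tri: "cmod (x + y) \<le> r + s" "cmod (x - y) \<le> r + s" if "cmod x \<le> r" "cmod y \<le> s" for x y r s
    using that norm_triangle_ineq[of x y] norm_triangle_ineq4[of x y] by linarith+
  define A B where "A i = cmod (coordA a i)" and "B i = cmod (coordA b i)" for i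
  have nonneg: "0 \<le> A i * B j" for i j by (simp add: A_def B_def)
  have prod: "cmod (coordA a i * coordA b j) \<le> A i * B j" for i j
    by (simp add: A_def B_def norm_mult)
  have 1: "cmod (coordA (a * b) I0) \<le> A I0 * B I0"
    by (simp only: coordA_mult coord_product.simps prod)
  have 2: "cmod (coordA (a * b) i) \<le> A I0 * B i + A i * B I0" if "i \<in> {I1, I2, I3, I4}" for i
    using that by (auto simp only: coordA_mult coord_product.simps insert_iff empty_iff intro!: tri prod)
  have 3: "cmod (coordA (a * b) I12) \<le>
      A I0 * B I12 + A I12 * B I0 + A I1 * B I2 + A I2 * B I1 + A I3 * B I4 + A I4 * B I3"
    unfolding coordA_mult coord_product.simps by (intro tri prod)
  have 4: "cmod (coordA (a * b) I13) \<le> A I0 * B I13 + A I13 * B I0 + A I1 * B I3 + A I3 * B I1"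
    unfolding coordA_mult coord_product.simps by (intro tri prod)
  have 5: "cmod (coordA (a * b) I14) \<le> A I0 * B I14 + A I14 * B I0 + A I1 * B I4 + A I4 * B I1"
    unfolding coordA_mult coord_product.simps by (intro tri prod)
  have 6: "cmod (coordA (a * b) I23) \<le> A I0 * B I23 + A I23 * B I0 + A I2 * B I3 + A I3 * B I2"
    unfolding coordA_mult coord_product.simps by (intro tri prod)
  have 7: "cmod (coordA (a * b) I24) \<le> A I0 * B I24 + A I24 * B I0 + A I2 * B I4 + A I4 * B I2"
    unfolding coordA_mult coord_product.simps by (intro tri prod)
  define S S' T T' where "S = A I1 + A I2 + A I3 + A I4" and "S' = B I1 + B I2 + B I3 + B I4"
    and "T = A I12 + A I13 + A I14 + A I23 + A I24" and "T' = B I12 + B I13 + B I14 + B I23 + B I24"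
  have sum_basis_index: "(\<Sum>i\<in>UNIV. f i) = f I0 + f I1 + f I2 + f I3 + f I4 + f I12 + f I13 + f I14 + f I23 + f I24"
    for f :: "basis_index \<Rightarrow> real"
    by (simp add: UNIV_basis_index)
  \<comment> \<open>The diagonal terms of \<open>S * S'\<close> come from squares of generators and
    occur in no coordinate bound; their nonnegativity closes the gap.\<close>
  have "l1_norm (a * b) \<le> A I0 * B I0 + A I0 * (S' + T') + (S + T) * B I0 + S * S'"
    using 1 2[of I1] 2[of I2] 2[of I3] 2[of I4] 3 4 5 6 7
      nonneg[of I1 I1] nonneg[of I2 I2] nonneg[of I3 I3] nonneg[of I4 I4]
    unfolding l1_norm_def sum_basis_index S_def S'_def T_def T'_def by (simp add: algebra_simps)
  also have "\<dots> \<le> (A I0 + S + T) * (B I0 + S' + T')"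
  proof -
    have "0 \<le> S * T'" "0 \<le> T * S'" "0 \<le> T * T'"
      by (simp_all add: S_def S'_def T_def T'_def A_def B_def)
    then show ?thesis by (simp add: algebra_simps)
  qed
  also have "\<dots> = l1_norm a * l1_norm b"
    by (simp add: l1_norm_def sum_basis_index S_def S'_def T_def T'_def A_def B_def add_ac)
  finally show "l1_norm (a * b) \<le> l1_norm a * l1_norm b" .
qed

section \<open>The bilinear functional\<close>

definition minor :: "algA \<Rightarrow> algA \<Rightarrow> complex"
  where "minor a b = coordA a I1 * coordA b I2 - coordA a I2 * coordA b I1"

text \<open>
  In terms of the \<open>2 \<times> 2\<close> minors \<open>p\<^sub>i\<^sub>j\<close> of the linear parts, \<open>[a, b] = 0\<close> says
  \<open>p\<^sub>1\<^sub>3 = p\<^sub>1\<^sub>4 = p\<^sub>2\<^sub>3 = p\<^sub>2\<^sub>4 = 0\<close> and \<open>p\<^sub>1\<^sub>2 = - p\<^sub>3\<^sub>4\<close>; the Pluecker relation then gives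
  \<open>p\<^sub>1\<^sub>2\<^sup>2 = 0\<close>.
\<close>

lemma minor_eq_0:
  assumes "lie_product a b = 0"
  shows "minor a b = 0"
proof -
  define p where "p i j = coordA a i * coordA b j - coordA a j * coordA b i" for i j
  have "coordA (lie_product a b) i = 0" for i by (simp add: assms coordA_zero)
  then have coords: "coord_product (coordA a) (coordA b) i = coord_product (coordA b) (coordA a) i" for i
    by (simp add: lie_product_def coordsA.coord_diff coordA_mult)
  \<comment> \<open>Terms involving \<open>I0\<close> are symmetric in \<open>a\<close> and
    \<open>b\<close> and cancel; what remains in each coordinate is twice the minor
    expression.\<close>
  have "p I1 I2 + p I3 I4 = 0" "p I1 I3 = 0" "p I1 I4 = 0"
    using coords[of I12] coords[of I13] coords[of I14]
    unfolding coord_product.simps p_def by algebra+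
  moreover have "p I1 I2 * p I3 I4 - p I1 I3 * p I2 I4 + p I1 I4 * p I2 I3 = 0"
    unfolding p_def by algebra
  ultimately have "p I1 I2 * p I1 I2 = 0" by algebra
  then show ?thesis by (simp add: p_def minor_def)
qed

lemma not_zero_Lie_product_determined:
  assumes "coordinatized_normed_algebra scaleA nrm basisA coordA"
  shows "\<not> zero_Lie_product_determined scaleA nrm"
proof
  assume det: "zero_Lie_product_determined scaleA nrm"
  interpret coordinatized_normed_algebra scaleA nrm basisA coordA by (rule assms)
  let ?T = "norm_topology nrm"
  have cont: "continuous_map (prod_topology ?T ?T) euclidean (\<lambda>x. coordA (fst x) i)"
    "continuous_map (prod_topology ?T ?T) euclidean (\<lambda>x. coordA (snd x) i)" for i
    using continuous_map_compose[OF continuous_map_fst continuous_coord]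
      continuous_map_compose[OF continuous_map_snd continuous_coord] by (simp_all add: o_def)
  have "continuous_map (prod_topology ?T ?T) euclidean (\<lambda>x. minor (fst x) (snd x))"
    unfolding minor_def
    by (intro continuous_map_binop[of _ _ _ "(-)"] continuous_map_binop[of _ _ _ "(*)"] cont)
      (auto simp: case_prod_beta intro!: continuous_intros)
  moreover have "Vector_Spaces.linear scaleA (*) (minor a)"
    "Vector_Spaces.linear scaleA (*) (\<lambda>a. minor a b)" for a b
    \<comment> \<open>Linearity of one coordinate supplies the vector space conditions on both
      scalar multiplications.\<close>
    using coordsA.linear_coord[of I0] unfolding Vector_Spaces.linear_iff
    by (simp_all add: minor_def coordA_add coordA_scale algebra_simps)
  ultimately have "continuous_bilinear_functional scaleA nrm minor"
    by (simp add: continuous_bilinear_functional_def case_prod_unfold)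
  with det minor_eq_0 obtain \<tau> where \<tau>: "\<And>a b. minor a b = \<tau> (lie_product a b)"
    unfolding zero_Lie_product_determined_def by blast
  have "lie_product (varA G1) (varA G2) = lie_product (varA G3) (varA G4)"
    by (simp add: lie_product_def varA_sorted)
  then have "minor (varA G1) (varA G2) = minor (varA G3) (varA G4)"
    by (simp add: \<tau>)
  then show False by (simp add: minor_def coordA_var)
qed

text \<open>The existence of a norm ensures that the claim about all submultiplicative norms is not
  vacuous.\<close>

theorem proposition2p2:
  shows "algA.dim (UNIV :: algA set) = 10
    \<and> (\<exists>nrm. normed_complex_algebra scaleA nrm)
    \<and> (\<forall>nrm. normed_complex_algebra scaleA nrm \<longrightarrow>
          complex_Banach_algebra scaleA nrm \<and> \<not> zero_Lie_product_determined scaleA nrm)"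
proof (intro conjI allI impI)
  show "algA.dim (UNIV :: algA set) = 10"
    using coordsA.dim_UNIV by (simp add: UNIV_basis_index)
  show "\<exists>nrm. normed_complex_algebra scaleA nrm"
    using normed_l1_norm by blast
  fix nrm assume "normed_complex_algebra scaleA nrm"
  then have *: "coordinatized_normed_algebra scaleA nrm basisA coordA"
    by (intro coordinatized_normed_algebra.intro coordsA.coordinatized_space_axioms)
  then show "complex_Banach_algebra scaleA nrm"
    by (rule coordinatized_normed_algebra.Banach)
  show "\<not> zero_Lie_product_determined scaleA nrm"
    using * by (rule not_zero_Lie_product_determined)
qed

end
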